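(* Let $P_t$ denote the path of length $t$ (i.e. with $t$ edges). Then, as $n\to\infty$: (i) $C(n,P_4)=\Omega(n^{1/5})$; (ii) $C(n,P_t)=\Omega(n^{1/3})$ for $t\in\{5,6,7\}$; (iii) $C(n,P_t)=\Omega(n^{1/2})$ for every $t\geqslant 8$.
   Context: For a graph $H$ and a positive integer $n$, $C(n,H)$ denotes the minimum integer $k$ such that there exist $n$ colorings $f_v:E(K_n)\to[k]$, one for each vertex $v\in V(K_n)$ (the colorings need not be proper), with the following property: for every copy $T$ of $H$ in $K_n$, there is a vertex $v\in V(T)$ such that $f_v$ assigns pairwise distinct colors to all edges of $E(T)$. *)

theory Defs
  imports Complex_Main "HOL-Library.FuncSet" "HOL-Library.Landau_Symbols"
begin

text \<open>A simple graph is a pair of a vertex set and a set of two-element sets of vertices.\<close>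

type_synonym 'a graph = "'a set \<times> 'a set set"

definition verts :: "'a graph \<Rightarrow> 'a set" where
  "verts G = fst G"

definition edges :: "'a graph \<Rightarrow> 'a set set" where
  "edges G = snd G"

definition simple_graph :: "'a graph \<Rightarrow> bool" where
  "simple_graph G \<longleftrightarrow> edges G \<subseteq> {e. e \<subseteq> verts G \<and> card e = 2}"

definition subgraph :: "'a graph \<Rightarrow> 'a graph \<Rightarrow> bool" where
  "subgraph T G \<longleftrightarrow> simple_graph T \<and> verts T \<subseteq> verts G \<and> edges T \<subseteq> edges G"

definition graph_iso :: "'a graph \<Rightarrow> 'b graph \<Rightarrow> bool" where
  "graph_iso H T \<longleftrightarrow>
     (\<exists>\<phi>. bij_betw \<phi> (verts H) (verts T) \<and> edges T = (\<lambda>e. \<phi> ` e) ` edges H)"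

text \<open>A copy need not be induced.\<close>

definition copy_in :: "'a graph \<Rightarrow> 'b graph \<Rightarrow> 'b graph \<Rightarrow> bool" where
  "copy_in H G T \<longleftrightarrow> subgraph T G \<and> graph_iso H T"

definition complete_graph :: "nat \<Rightarrow> nat graph" where
  "complete_graph n = ({1..n}, {e. e \<subseteq> {1..n} \<and> card e = 2})"

text \<open>The path of length \<open>t\<close> has \<open>t\<close> edges, hence \<open>t + 1\<close> vertices.\<close>

definition path_graph :: "nat \<Rightarrow> nat graph" where
  "path_graph t = ({0..t}, {{i, Suc i} | i. i < t})"

definition good_colorings ::
    "nat \<Rightarrow> 'a graph \<Rightarrow> nat \<Rightarrow> (nat \<Rightarrow> nat set \<Rightarrow> nat) \<Rightarrow> bool" where
  "good_colorings n H k f \<longleftrightarrow>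
     (\<forall>v\<in>verts (complete_graph n). f v \<in> edges (complete_graph n) \<rightarrow> {1..k}) \<and>
     (\<forall>T. copy_in H (complete_graph n) T \<longrightarrow> (\<exists>v\<in>verts T. inj_on (f v) (edges T)))"

text \<open>
  For \<open>H\<close> with at least one vertex the minimum exists: all \<open>f v\<close> may be one and the same
  injective coloring with \<open>n choose 2\<close> colors.
\<close>

definition C_num :: "nat \<Rightarrow> 'a graph \<Rightarrow> nat" where
  "C_num n H = (LEAST k. \<exists>f. good_colorings n H k f)"

end

theory Submission
  imports Defs
begin

text \<open>
  Only cherries, i.e. two consecutive edges \<open>yx\<close>, \<open>xz\<close> of the path, are used to spoil the
  colorings. Suppose there are few colors.

  For \<open>t \<ge> 5\<close> fix \<open>x\<close>. Among \<open>2k\<close> vertices joined to \<open>x\<close> by one color of \<open>f\<^sub>x\<close>, averaging gives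
  \<open>y\<close>, \<open>z\<close> such that \<open>f\<^sub>u(yx) = f\<^sub>u(xz)\<close> for all \<open>u\<close> in a set \<open>W\<close> of at least \<open>n/(4k)\<close> vertices.
  Start the path with \<open>y x z\<close> and take every other vertex from \<open>W\<close>; then only \<open>f\<^sub>y\<close> and \<open>f\<^sub>z\<close>
  remain to be spoiled. If \<open>|W|\<close> exceeds about \<open>k\<^sup>2\<close>, one further cherry inside \<open>W\<close> does this by
  the pigeonhole principle, which needs six vertices. If \<open>|W|\<close> only exceeds about \<open>k\<close>, two further
  cherries are needed, hence nine vertices.

  For \<open>t = 4\<close> averaging gives \<open>a\<close>, \<open>c\<close>, \<open>e\<close> such that \<open>f\<^sub>u(ua) = f\<^sub>u(uc) = f\<^sub>u(ue)\<close> for about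
  \<open>n/k\<^sup>2\<close> vertices \<open>u\<close>. If there are more than \<open>k\<^sup>3\<close> of them, two of them, \<open>b\<close> and \<open>d\<close>, are such
  that the cherry \<open>b c d\<close> is monochromatic in \<open>f\<^sub>a\<close>, \<open>f\<^sub>c\<close> and \<open>f\<^sub>e\<close>, and \<open>a b c d e\<close> is the path.
\<close>

section \<open>Pigeonhole principles and averaging over monochromatic subsets\<close>

lemma pigeonhole_monochromatic_subset:
  assumes "finite A" "finite K" "g \<in> A \<rightarrow> K" "card K * (s - 1) < card A"
  obtains B where "B \<subseteq> A" "card B = s" "\<And>x y. x \<in> B \<Longrightarrow> y \<in> B \<Longrightarrow> g x = g y"
proof -
  have "\<exists>c\<in>K. s \<le> card {x \<in> A. g x = c}"
  proof (rule ccontr)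
    assume "\<not> ?thesis"
    then have "\<And>c. c \<in> K \<Longrightarrow> card {x \<in> A. g x = c} \<le> s - 1"
      by force
    then have "(\<Sum>c\<in>K. card {x \<in> A. g x = c}) \<le> card K * (s - 1)"
      using sum_bounded_above[of K "\<lambda>c. card {x \<in> A. g x = c}" "s - 1"] by simp
    moreover have "(\<Sum>c\<in>K. card {x \<in> A. g x = c}) = card A"
      using sum.group[of A K g "\<lambda>_. 1::nat"] assms by (simp add: image_subset_iff_funcset)
    ultimately show False
      using assms(4) by simp
  qed
  then obtain c where "s \<le> card {x \<in> A. g x = c}"
    by blast
  then obtain B where "B \<subseteq> {x \<in> A. g x = c}" "card B = s"
    by (meson obtain_subset_with_card_n)
  then show thesis
    using that[of B] by blast
qed

lemma pigeonhole_pair: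
  assumes "finite A" "finite K" "g \<in> A \<rightarrow> K" "card K < card A"
  obtains x y where "x \<in> A" "y \<in> A" "x \<noteq> y" "g x = g y"
  using assms pigeonhole[of g A] card_mono[of K "g ` A"]
  by (metis image_subset_iff_funcset inj_on_def le_less_trans)

definition mono_subsets :: "('a \<Rightarrow> 'b) \<Rightarrow> nat \<Rightarrow> 'a set \<Rightarrow> 'a set set" where
  "mono_subsets g s A = {B. B \<subseteq> A \<and> card B = s \<and> (\<forall>x\<in>B. \<forall>y\<in>B. g x = g y)}"

lemma finite_mono_subsets: "finite A \<Longrightarrow> finite (mono_subsets g s A)"
  by (rule finite_subset[of _ "Pow A"]) (auto simp: mono_subsets_def)

text \<open>As long as \<open>A\<close> has more than \<open>card K * (s - 1)\<close> points,
  pigeonhole supplies a monochromatic \<open>s\<close>-set. Deleting one of its points destroys that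
  set, so every further deletion yields a new one; this is the induction on
  \<open>card A\<close>.\<close>

lemma card_mono_subsets_ge:
  assumes "finite A" "finite K" "g \<in> A \<rightarrow> K" "s > 0"
  shows "card A \<le> card (mono_subsets g s A) + card K * (s - 1)"
  using assms
proof (induction "card A" arbitrary: A)
  case 0
  then show ?case by simp
next
  case (Suc m)
  show ?case
  proof (cases "card K * (s - 1) < card A")
    case False
    then show ?thesis by simp
  next
    case True
    then obtain B where B: "B \<subseteq> A" "card B = s" "\<And>x y. x \<in> B \<Longrightarrow> y \<in> B \<Longrightarrow> g x = g y"
      using pigeonhole_monochromatic_subset[OF Suc.prems(1-3)] by metis
    then obtain x where x: "x \<in> B" "x \<in> A"
      using \<open>s > 0\<close> by (metis card_gt_0_iff equals0I subsetD)
    have IH: "card (A - {x}) \<le> card (mono_subsets g s (A - {x})) + card K * (s - 1)"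
      using Suc.prems Suc.hyps(2) x by (intro Suc.hyps(1)) auto
    have "insert B (mono_subsets g s (A - {x})) \<subseteq> mono_subsets g s A"
      using B unfolding mono_subsets_def by blast
    then have "card (insert B (mono_subsets g s (A - {x}))) \<le> card (mono_subsets g s A)"
      using Suc.prems finite_mono_subsets by (intro card_mono)
    moreover have "B \<notin> mono_subsets g s (A - {x})"
      using x by (auto simp: mono_subsets_def)
    ultimately have "Suc (card (mono_subsets g s (A - {x}))) \<le> card (mono_subsets g s A)"
      using Suc.prems finite_mono_subsets[of "A - {x}" g s] by simp
    then show ?thesis
      using IH x Suc.prems by (simp add: card_Diff_singleton)
  qed
qed

text \<open>Double counting of pairs \<open>(u, B)\<close> with \<open>B\<close> monochromatic under
  \<open>g u\<close>: every \<open>u\<close> lies in at least \<open>card K\<close> pairs, while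
  there are at most \<open>(s * card K) ^ s\<close> candidates \<open>B\<close>. The most frequent
  \<open>B\<close> is therefore monochromatic for a large part of \<open>U\<close>.\<close>

lemma exists_popular_mono_subset:
  assumes "finite A" "finite K" "K \<noteq> {}" "finite U" "s > 0" "card A = s * card K"
    and g: "\<And>u. u \<in> U \<Longrightarrow> g u \<in> A \<rightarrow> K"
  obtains B where "B \<subseteq> A" "card B = s"
    "card U * card K \<le> card {u \<in> U. \<forall>x\<in>B. \<forall>y\<in>B. g u x = g u y} * (s * card K) ^ s"
proof -
  let ?S = "{B. B \<subseteq> A \<and> card B = s}"
  let ?R = "\<lambda>B. {u \<in> U. \<forall>x\<in>B. \<forall>y\<in>B. g u x = g u y}"
  have fS: "finite ?S"
    using \<open>finite A\<close> by (auto intro: finite_subset[of _ "Pow A"])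
  have "s \<le> card A"
    using assms by (simp add: Suc_le_eq card_gt_0_iff)
  then have cS: "card ?S \<le> (s * card K) ^ s" "?S \<noteq> {}"
    using n_subsets[OF \<open>finite A\<close>, of s] binomial_le_pow[of s "card A"] assms(6)
      obtain_subset_with_card_n[of s A] by auto
  \<comment> \<open>The size \<open>s * card K\<close> of \<open>A\<close> exceeds the threshold
    \<open>card K * (s - 1)\<close> by exactly \<open>card K\<close>.\<close>
  have "card K \<le> card (mono_subsets (g u) s A)" if "u \<in> U" for u
    using card_mono_subsets_ge[OF assms(1,2) g[OF that] \<open>s > 0\<close>] assms(5,6)
    by (cases s) auto
  then have "card U * card K \<le> (\<Sum>u\<in>U. card (mono_subsets (g u) s A))"
    using sum_bounded_below[of U "card K" "\<lambda>u. card (mono_subsets (g u) s A)"] by simp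
  also have "\<dots> = (\<Sum>u\<in>U. card {B \<in> ?S. \<forall>x\<in>B. \<forall>y\<in>B. g u x = g u y})"
    by (simp add: mono_subsets_def)
  also have "\<dots> = (\<Sum>B\<in>?S. card (?R B))"
    using sum_multicount_gen[OF \<open>finite U\<close> fS,
        of "\<lambda>u B. \<forall>x\<in>B. \<forall>y\<in>B. g u x = g u y" "\<lambda>B. card (?R B)"] by simp
  finally have le: "card U * card K \<le> (\<Sum>B\<in>?S. card (?R B))" .
  obtain B where B: "B \<in> ?S" "\<And>B'. B' \<in> ?S \<Longrightarrow> card (?R B') \<le> card (?R B)"
  proof -
    have "Max ((\<lambda>B. card (?R B)) ` ?S) \<in> (\<lambda>B. card (?R B)) ` ?S"
      using fS cS(2) by (intro Max_in) auto
    then obtain B where "B \<in> ?S" "Max ((\<lambda>B. card (?R B)) ` ?S) = card (?R B)"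
      by blast
    then show thesis
      using that[of B] fS by (metis (no_types, lifting) Max_ge finite_imageI imageI)
  qed
  have "(\<Sum>B\<in>?S. card (?R B)) \<le> card ?S * card (?R B)"
    using sum_bounded_above[of ?S "\<lambda>B. card (?R B)" "card (?R B)"] B(2) by simp
  also have "\<dots> \<le> (s * card K) ^ s * card (?R B)"
    using cS(1) by (rule mult_right_mono) simp
  finally show thesis
    using that[of B] le B(1) by (simp add: mult.commute)
qed

section \<open>Paths as vertex lists, and basic facts on good colorings\<close>

lemma path_copy_of_list:
  assumes "distinct ps" "length ps = Suc t" "set ps \<subseteq> {1..n}"
  shows "copy_in (path_graph t) (complete_graph n)
           (set ps, {{ps ! i, ps ! Suc i} | i. i < t})"
proof -
  have card2: "card {ps ! i, ps ! Suc i} = 2" if "i < t" for i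
    using that assms by (simp add: nth_eq_iff_index_eq)
  have sub: "{ps ! i, ps ! Suc i} \<subseteq> set ps" if "i < t" for i
    using that assms by simp
  have "bij_betw ((!) ps) {0..t} (set ps)"
    using bij_betw_nth[OF assms(1), of "{0..t}" "set ps"] assms(2)
    by (simp add: atLeast0AtMost lessThan_Suc_atMost)
  moreover have "{{ps ! i, ps ! Suc i} | i. i < t} = (\<lambda>e. (!) ps ` e) ` {{i, Suc i} | i. i < t}"
  proof -
    have "{{i, Suc i} | i. i < t} = (\<lambda>i. {i, Suc i}) ` {..<t}"
      "{{ps ! i, ps ! Suc i} | i. i < t} = (\<lambda>i. {ps ! i, ps ! Suc i}) ` {..<t}"
      by blast+
    then show ?thesis
      by (simp add: image_image)
  qed
  ultimately have "graph_iso (path_graph t) (set ps, {{ps ! i, ps ! Suc i} | i. i < t})"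
    unfolding graph_iso_def path_graph_def verts_def edges_def fst_conv snd_conv by blast
  moreover have "subgraph (set ps, {{ps ! i, ps ! Suc i} | i. i < t}) (complete_graph n)"
    using card2 sub assms(3)
    by (auto simp: subgraph_def simple_graph_def complete_graph_def verts_def edges_def)
  ultimately show ?thesis
    by (simp add: copy_in_def)
qed

text \<open>The two edges of a cherry are different edges of the path, so equal colors on them
  refute injectivity of \<open>f v\<close>. Each later bound ends by building such a list.\<close>

lemma good_colorings_no_spoiled_path:
  assumes good: "good_colorings n (path_graph t) k f"
    and ps: "distinct ps" "length ps = Suc t" "set ps \<subseteq> {1..n}"
    and spoiled: "\<And>v. v \<in> set ps \<Longrightarrow>
      \<exists>as y x z bs. ps = as @ [y, x, z] @ bs \<and> f v {x, y} = f v {x, z}"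
  shows False
proof -
  let ?E = "{{ps ! i, ps ! Suc i} | i. i < t}"
  obtain v where v: "v \<in> set ps" "inj_on (f v) ?E"
    using good path_copy_of_list[OF ps] unfolding good_colorings_def
    by (fastforce simp: verts_def edges_def)
  obtain as y x z bs where d: "ps = as @ [y, x, z] @ bs" "f v {x, y} = f v {x, z}"
    using spoiled[OF v(1)] by blast
  have "{x, y} = {ps ! length as, ps ! Suc (length as)}" "length as < t"
    "{x, z} = {ps ! Suc (length as), ps ! Suc (Suc (length as))}" "Suc (length as) < t"
    using d(1) ps(2) by (auto simp: nth_append)
  then have "{x, y} \<in> ?E" "{x, z} \<in> ?E"
    by blast+
  then have "{x, y} = {x, z}"
    using v(2) d(2) by (meson inj_onD)
  then show False
    using ps(1) d(1) by (auto simp: doubleton_eq_iff)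
qed

lemma good_colorings_color:
  assumes "good_colorings n H k f" "v \<in> {1..n}" "x \<in> {1..n}" "y \<in> {1..n}" "x \<noteq> y"
  shows "f v {x, y} \<in> {1..k}"
  using assms unfolding good_colorings_def
  by (auto simp: complete_graph_def verts_def edges_def Pi_iff)

lemma good_colorings_pos:
  assumes "good_colorings n H k f" "n \<ge> 2"
  shows "k \<ge> 1"
  using good_colorings_color[OF assms(1), of 1 1 2] assms(2) by auto

lemma good_colorings_exists: "\<exists>k f. good_colorings n (path_graph t) k f"
proof -
  let ?E = "edges (complete_graph n)"
  have "finite ?E"
    by (rule finite_subset[of _ "Pow {1..n}"]) (auto simp: complete_graph_def edges_def)
  then obtain h where h: "bij_betw h ?E {1..card ?E}"
    using finite_same_card_bij[of ?E "{1..card ?E}"] by auto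
  have "\<exists>v\<in>verts T. inj_on h (edges T)" if "copy_in (path_graph t) (complete_graph n) T" for T
  proof -
    have "verts T \<noteq> {}" "edges T \<subseteq> ?E"
      using that
      by (auto simp: copy_in_def graph_iso_def subgraph_def path_graph_def verts_def bij_betw_def)
    then show ?thesis
      using h by (auto simp: bij_betw_def intro: inj_on_subset)
  qed
  then have "good_colorings n (path_graph t) (card ?E) (\<lambda>_. h)"
    using h by (auto simp: good_colorings_def bij_betw_def)
  then show ?thesis by blast
qed

section \<open>Finding monochromatic cherries\<close>

text \<open>The set \<open>A\<close> is made monochromatic for the center's own coloring before
  averaging, so whichever pair in \<open>A\<close> turns out popular also spoils \<open>f x\<close>.
  Its size \<open>2 * k\<close> is what the averaging requires for pairs.\<close>

lemma exists_cherry_spoiling_many: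
  assumes good: "good_colorings n H k f" and "k \<ge> 1" "2 * k\<^sup>2 < n"
  obtains x y z W where "{x, y, z} \<subseteq> {1..n}" "distinct [x, y, z]"
    "W \<subseteq> {1..n} - {x, y, z}" "n \<le> 4 * k * (card W + 3)"
    "f x {x, y} = f x {x, z}" "\<forall>u\<in>W. f u {x, y} = f u {x, z}"
proof -
  have x: "1 \<in> {1..n}"
    using assms by auto
  have col: "f u {1, v} \<in> {1..k}" if "u \<in> {1..n}" "v \<in> {2..n}" for u v
    using good_colorings_color[OF good, of u 1 v] that by auto
  have "card {1..k} * (2 * k - 1) < card {2..n}"
  proof -
    have "k * (2 * k - 1) + k = 2 * k\<^sup>2"
      using \<open>k \<ge> 1\<close> by (simp add: power2_eq_square algebra_simps diff_mult_distrib2)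
    then show ?thesis
      using assms by simp
  qed
  then obtain A where A: "A \<subseteq> {2..n}" "card A = 2 * k"
    "\<And>v w. v \<in> A \<Longrightarrow> w \<in> A \<Longrightarrow> f 1 {1, v} = f 1 {1, w}"
    using pigeonhole_monochromatic_subset[of "{2..n}" "{1..k}" "\<lambda>v. f 1 {1, v}" "2 * k"] col[OF x]
    by auto
  have "finite A"
    using A(1) finite_subset by blast
  then obtain B where B: "B \<subseteq> A" "card B = 2"
    "n * k \<le> card {u \<in> {1..n}. \<forall>v\<in>B. \<forall>w\<in>B. f u {1, v} = f u {1, w}} * (2 * k)\<^sup>2"
    using exists_popular_mono_subset[of A "{1..k}" "{1..n}" 2 "\<lambda>u v. f u {1, v}"] A(1,2) col \<open>k \<ge> 1\<close>
    by (auto simp: subset_iff)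
  obtain y z where yz: "B = {y, z}" "y \<noteq> z"
    using B(2) by (auto simp: card_2_iff)
  define W' where "W' = {u \<in> {1..n}. f u {1, y} = f u {1, z}}"
  have W': "{u \<in> {1..n}. \<forall>v\<in>B. \<forall>w\<in>B. f u {1, v} = f u {1, w}} = W'"
    using yz by (auto simp: W'_def)
  have "n * k \<le> (4 * k * card W') * k"
    using B(3) unfolding W' by (simp add: power2_eq_square algebra_simps)
  then have le: "n \<le> 4 * k * card W'"
    using \<open>k \<ge> 1\<close> by simp
  show thesis
  \<comment> \<open>Removing the cherry's own vertices keeps \<open>W\<close> disjoint from it, at
    the price of the \<open>+ 3\<close> in the bound.\<close>
  proof (rule that[of 1 y z "W' - {1, y, z}"])
    have "y \<in> {2..n}" "z \<in> {2..n}"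
      using yz(1) B(1) A(1) by blast+
    then show "{1, y, z} \<subseteq> {1..n}" "distinct [1, y, z]"
      using yz(2) by auto
    show "W' - {1, y, z} \<subseteq> {1..n} - {1, y, z}"
      by (auto simp: W'_def)
    have "card W' - card {1, y, z} \<le> card (W' - {1, y, z})"
      by (rule diff_card_le_card_Diff) simp
    moreover have "card {1, y, z} \<le> 3"
      by (simp add: card_insert_if)
    ultimately have "card W' \<le> card (W' - {1, y, z}) + 3"
      by linarith
    then show "n \<le> 4 * k * (card (W' - {1, y, z}) + 3)"
      using le by (meson le_trans mult_le_mono2)
    show "f 1 {1, y} = f 1 {1, z}"
      using A(3)[of y z] B(1) yz(1) by simp
    show "\<forall>u\<in>W' - {1, y, z}. f u {1, y} = f u {1, z}"
      by (simp add: W'_def)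
  qed
qed

lemma obtain_distinct_list:
  assumes "m \<le> card A"
  obtains ws where "distinct ws" "length ws = m" "set ws \<subseteq> A"
proof -
  obtain B where "B \<subseteq> A" "card B = m" "finite B"
    using assms by (rule obtain_subset_with_card_n)
  then show thesis
    using that by (metis distinct_card finite_distinct_list)
qed

text \<open>Any \<open>x\<close> in \<open>W\<close> can be the center: each other vertex of
  \<open>W\<close> gets the tuple of colors of its edge to \<open>x\<close> under the colorings of
  \<open>vs\<close>, and there are only \<open>k ^ length vs\<close> tuples. The \<open>+ 1\<close>
  in the hypothesis pays for \<open>x\<close>.\<close>

lemma obtain_cherry:
  assumes good: "good_colorings n H k f"
    and "W \<subseteq> {1..n}" "distinct vs" "set vs \<subseteq> {1..n}" "k ^ length vs + 1 < card W"
  obtains x y z where "{x, y, z} \<subseteq> W" "distinct [x, y, z]"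
    "\<forall>v\<in>set vs. f v {x, y} = f v {x, z}"
proof -
  have "finite W"
    using assms(2) finite_subset by blast
  then obtain x where x: "x \<in> W"
    using assms(5) by (metis all_not_in_conv card.empty not_less_zero)
  \<comment> \<open>Restricting to \<open>set vs\<close> puts the tuples into a finite extensional
    function space, whose cardinality is known.\<close>
  let ?g = "\<lambda>y. \<lambda>v\<in>set vs. f v {x, y}"
  have "?g \<in> W - {x} \<rightarrow> (set vs \<rightarrow>\<^sub>E {1..k})"
    using good_colorings_color[OF good] x assms(2,4) by (auto simp: subset_iff)
  moreover have "card (set vs \<rightarrow>\<^sub>E {1..k}) < card (W - {x})"
    using assms(3,5) x \<open>finite W\<close> by (simp add: card_funcsetE distinct_card)
  ultimately obtain y z where "y \<in> W - {x}" "z \<in> W - {x}" "y \<noteq> z" and eq: "?g y = ?g z"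
    using pigeonhole_pair[of "W - {x}" "set vs \<rightarrow>\<^sub>E {1..k}" ?g] \<open>finite W\<close>
    by (metis finite_Diff finite_PiE finite_atLeastAtMost List.finite_set)
  moreover have "f v {x, y} = f v {x, z}" if "v \<in> set vs" for v
    using fun_cong[OF eq, of v] that by simp
  ultimately show thesis
    using that[of x y z] x by auto
qed

section \<open>Polynomial upper bounds on \<open>n\<close> for the three ranges of path
  lengths\<close>

lemma good_colorings_path_ge_5:
  assumes good: "good_colorings n (path_graph t) k f" and "n \<ge> 2" "t \<ge> 5"
  shows "n \<le> 4 * (t + 11) * k ^ 3"
proof (rule ccontr)
  assume "\<not> ?thesis"
  then have n: "4 * (t + 11) * k ^ 3 < n"
    by simp
  have k: "k \<ge> 1"
    using good_colorings_pos assms by blast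
  have "2 * k\<^sup>2 \<le> 4 * (t + 11) * k ^ 3"
    using k by (intro mult_mono power_increasing) auto
  then have "2 * k\<^sup>2 < n"
    using n by linarith
  then obtain x y z W where xyz: "{x, y, z} \<subseteq> {1..n}" "distinct [x, y, z]"
    and W: "W \<subseteq> {1..n} - {x, y, z}" "n \<le> 4 * k * (card W + 3)"
    and sp: "f x {x, y} = f x {x, z}" "\<forall>u\<in>W. f u {x, y} = f u {x, z}"
    by (rule exists_cherry_spoiling_many[OF good k]) blast
  have "finite W"
    using W(1) finite_subset by blast
  have "4 * k * ((t + 11) * k\<^sup>2) < 4 * k * (card W + 3)"
    using n W(2) by (simp add: power2_eq_square power3_eq_cube algebra_simps)
  then have "(t + 11) * k\<^sup>2 < card W + 3"
    by simp
  \<comment> \<open>One of the \<open>t + 11\<close> copies of \<open>k\<^sup>2\<close> is kept for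
    the pigeonhole; the others leave room for the lost \<open>3\<close> and for the tail of the
    path.\<close>
  moreover have "k\<^sup>2 + (t + 10) * 1 \<le> k\<^sup>2 + (t + 10) * k\<^sup>2"
    using k by (intro add_left_mono mult_left_mono) auto
  ultimately have cW: "k\<^sup>2 + t + 7 < card W"
    by (simp add: algebra_simps)
  have "W \<subseteq> {1..n}" "distinct [y, z]" "set [y, z] \<subseteq> {1..n}" "k ^ length [y, z] + 1 < card W"
    using W(1) xyz cW by (auto simp: power2_eq_square)
  then obtain x' y' z' where c': "{x', y', z'} \<subseteq> W" "distinct [x', y', z']"
    "\<forall>v\<in>set [y, z]. f v {x', y'} = f v {x', z'}"
    by (rule obtain_cherry[OF good]) blast
  have "t - 5 \<le> card (W - {x', y', z'})"
    using c' cW \<open>finite W\<close> by (simp add: card_Diff_subset)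
  then obtain ws where ws: "distinct ws" "length ws = t - 5" "set ws \<subseteq> W - {x', y', z'}"
    by (rule obtain_distinct_list)
  \<comment> \<open>Centers stand in the middle of their triples. The first triple spoils
    \<open>x\<close> and all of \<open>W\<close>, the second spoils \<open>y\<close> and
    \<open>z\<close>.\<close>
  let ?ps = "[y, x, z, y', x', z'] @ ws"
  show False
  proof (rule good_colorings_no_spoiled_path[OF good, of ?ps])
    show "distinct ?ps" "set ?ps \<subseteq> {1..n}"
      using xyz c' ws W(1) by auto
    show "length ?ps = Suc t"
      using ws \<open>t \<ge> 5\<close> by simp
    fix v
    assume "v \<in> set ?ps"
    then consider "v = y \<or> v = z" | "v = x \<or> v \<in> W"
      using c' ws by auto
    then show "\<exists>as y x z bs. ?ps = as @ [y, x, z] @ bs \<and> f v {x, y} = f v {x, z}"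
    proof cases
      case 1
      then have "?ps = [y, x, z] @ [y', x', z'] @ ws \<and> f v {x', y'} = f v {x', z'}"
        using c' by auto
      then show ?thesis by blast
    next
      case 2
      then have "?ps = [] @ [y, x, z] @ ([y', x', z'] @ ws) \<and> f v {x, y} = f v {x, z}"
        using sp by auto
      then show ?thesis by blast
    qed
  qed
qed

text \<open>Treating \<open>y\<close> and \<open>z\<close> by separate disjoint cherries replaces
  one pigeonhole with \<open>k\<^sup>2\<close> color pairs by two with \<open>k\<close> colors each,
  which saves a factor \<open>k\<close> and costs three more path vertices.\<close>

lemma good_colorings_path_ge_8:
  assumes good: "good_colorings n (path_graph t) k f" and "n \<ge> 2" "t \<ge> 8"
  shows "n \<le> 4 * (t + 11) * k\<^sup>2"
proof (rule ccontr)
  assume "\<not> ?thesis"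
  then have n: "4 * (t + 11) * k\<^sup>2 < n"
    by simp
  have k: "k \<ge> 1"
    using good_colorings_pos assms by blast
  have "2 * k\<^sup>2 \<le> 4 * (t + 11) * k\<^sup>2"
    by (intro mult_right_mono) auto
  then have "2 * k\<^sup>2 < n"
    using n by linarith
  then obtain x y z W where xyz: "{x, y, z} \<subseteq> {1..n}" "distinct [x, y, z]"
    and W: "W \<subseteq> {1..n} - {x, y, z}" "n \<le> 4 * k * (card W + 3)"
    and sp: "f x {x, y} = f x {x, z}" "\<forall>u\<in>W. f u {x, y} = f u {x, z}"
    by (rule exists_cherry_spoiling_many[OF good k]) blast
  have "finite W"
    using W(1) finite_subset by blast
  have "4 * k * ((t + 11) * k) < 4 * k * (card W + 3)"
    using n W(2) by (simp add: power2_eq_square algebra_simps)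
  then have "(t + 11) * k < card W + 3"
    by simp
  moreover have "k + (t + 10) * 1 \<le> k + (t + 10) * k"
    using k by (intro add_left_mono mult_left_mono) auto
  ultimately have cW: "k + t + 7 < card W"
    by (simp add: algebra_simps)
  have "W \<subseteq> {1..n}" "distinct [y]" "set [y] \<subseteq> {1..n}" "k ^ length [y] + 1 < card W"
    using W(1) xyz cW by (auto simp: power2_eq_square)
  then obtain x' y' z' where c': "{x', y', z'} \<subseteq> W" "distinct [x', y', z']"
    "\<forall>v\<in>set [y]. f v {x', y'} = f v {x', z'}"
    by (rule obtain_cherry[OF good]) blast
  let ?W = "W - {x', y', z'}"
  have cW': "k + t + 4 < card ?W"
    using c' cW \<open>finite W\<close> by (simp add: card_Diff_subset)
  have "?W \<subseteq> {1..n}" "distinct [z]" "set [z] \<subseteq> {1..n}" "k ^ length [z] + 1 < card ?W"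
    using W(1) xyz cW' by (auto simp: power2_eq_square)
  then obtain x'' y'' z'' where c'': "{x'', y'', z''} \<subseteq> ?W" "distinct [x'', y'', z'']"
    "\<forall>v\<in>set [z]. f v {x'', y''} = f v {x'', z''}"
    by (rule obtain_cherry[OF good]) blast
  have "t - 8 \<le> card (?W - {x'', y'', z''})"
    using diff_card_le_card_Diff[of "{x'', y'', z''}" ?W] c''(2) cW' by simp
  then obtain ws where ws: "distinct ws" "length ws = t - 8" "set ws \<subseteq> ?W - {x'', y'', z''}"
    by (rule obtain_distinct_list)
  let ?ps = "[y, x, z, y', x', z', y'', x'', z''] @ ws"
  show False
  proof (rule good_colorings_no_spoiled_path[OF good, of ?ps])
    show "distinct ?ps" "set ?ps \<subseteq> {1..n}"
      using xyz c' c'' ws W(1) by auto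
    show "length ?ps = Suc t"
      using ws \<open>t \<ge> 8\<close> by simp
    fix v
    assume "v \<in> set ?ps"
    then consider "v = y" | "v = z" | "v = x \<or> v \<in> W"
      using c' c'' ws by auto
    then show "\<exists>as y x z bs. ?ps = as @ [y, x, z] @ bs \<and> f v {x, y} = f v {x, z}"
    proof cases
      case 1
      then have "?ps = [y, x, z] @ [y', x', z'] @ ([y'', x'', z''] @ ws)
          \<and> f v {x', y'} = f v {x', z'}"
        using c' by auto
      then show ?thesis by blast
    next
      case 2
      then have "?ps = [y, x, z, y', x', z'] @ [y'', x'', z''] @ ws
          \<and> f v {x'', y''} = f v {x'', z''}"
        using c'' by auto
      then show ?thesis by blast
    next
      case 3
      then have "?ps = [] @ [y, x, z] @ ([y', x', z', y'', x'', z''] @ ws)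
          \<and> f v {x, y} = f v {x, z}"
        using sp by auto
      then show ?thesis by blast
    qed
  qed
qed

text \<open>Averaging over triples loses a factor \<open>(3 * k) ^ 3 / k\<close>, and the final
  pigeonhole needs more than \<open>k ^ 3\<close> vertices; together this is
  \<open>27 * k ^ 5\<close>. The remaining \<open>3 * k ^ 5\<close> covers the \<open>3 * k\<close>
  vertices set aside as \<open>A\<close>.\<close>

lemma good_colorings_path_4:
  assumes good: "good_colorings n (path_graph 4) k f" and "n \<ge> 2"
  shows "n \<le> 30 * k ^ 5"
proof (rule ccontr)
  assume "\<not> ?thesis"
  then have n: "30 * k ^ 5 < n"
    by simp
  have k: "k \<ge> 1"
    using good_colorings_pos assms by blast
  have "k ^ 1 \<le> k ^ 5"
    using k by (intro power_increasing) auto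
  then have n': "27 * k ^ 5 + 3 * k < n"
    using n by simp
  \<comment> \<open>The path will alternate between \<open>A\<close> and \<open>U\<close>; their
    disjointness makes every \<open>{u, a}\<close> a genuine edge.\<close>
  define A where "A = {1..3 * k}"
  define U where "U = {3 * k <..n}"
  have AU: "A \<subseteq> {1..n}" "U \<subseteq> {1..n}" "A \<inter> U = {}" "finite A" "finite U"
    using n' by (auto simp: A_def U_def)
  have cA: "card A = 3 * card {1..k}" and cU: "27 * k ^ 5 < card U"
    using n' by (auto simp: A_def U_def)
  have "f u {u, a} \<in> {1..k}" if "u \<in> U" "a \<in> A" for u a
    using good_colorings_color[OF good, of u u a] AU that by blast
  then obtain B where B: "B \<subseteq> A" "card B = 3"
    "card U * k \<le> card {u \<in> U. \<forall>v\<in>B. \<forall>w\<in>B. f u {u, v} = f u {u, w}} * (3 * k) ^ 3"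
    using exists_popular_mono_subset[of A "{1..k}" U 3 "\<lambda>u a. f u {u, a}"] AU(4,5) cA k
    by auto
  obtain a c e where ace: "B = {a, c, e}" "distinct [a, c, e]"
    using B(2) by (auto simp: card_3_iff)
  define V where "V = {u \<in> U. f u {u, a} = f u {u, c} \<and> f u {u, c} = f u {u, e}}"
  have V: "{u \<in> U. \<forall>v\<in>B. \<forall>w\<in>B. f u {u, v} = f u {u, w}} = V"
    using ace by (auto simp: V_def)
  have "27 * k ^ 5 * k < card U * k"
    using cU k by simp
  also have "\<dots> \<le> card V * (3 * k) ^ 3"
    using B(3) unfolding V .
  finally have "(27 * k ^ 3) * k ^ 3 < (27 * k ^ 3) * card V"
    by (simp add: eval_nat_numeral algebra_simps)
  then have cV: "k ^ 3 < card V"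
    by simp
  have fV: "finite V"
    using AU by (simp add: V_def)
  \<comment> \<open>Here \<open>c\<close> is the center, so that \<open>b c d\<close> becomes the
    middle cherry, while \<open>a b c\<close> and \<open>c d e\<close> already spoil
    \<open>b\<close> and \<open>d\<close> by the choice of \<open>V\<close>.\<close>
  let ?g = "\<lambda>u. \<lambda>v\<in>B. f v {c, u}"
  have "?g \<in> V \<rightarrow> (B \<rightarrow>\<^sub>E {1..k})"
  proof (intro Pi_I PiE_I)
    fix u v
    assume "u \<in> V" "v \<in> B"
    then have "v \<in> A" "c \<in> A" "u \<in> U"
      using B(1) ace(1) by (auto simp: V_def)
    then have "f v {c, u} \<in> {1..k}"
      using good_colorings_color[OF good, of v c u] AU by blast
    then show "?g u v \<in> {1..k}"
      using \<open>v \<in> B\<close> by simp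
  qed simp
  moreover have "finite B"
    using ace by simp
  moreover from this have "card (B \<rightarrow>\<^sub>E {1..k}) < card V"
    using cV B(2) by (simp add: card_funcsetE)
  ultimately obtain b d where bd: "b \<in> V" "d \<in> V" "b \<noteq> d" and eq: "?g b = ?g d"
    using pigeonhole_pair[of V "B \<rightarrow>\<^sub>E {1..k}" ?g] fV by (metis finite_PiE finite_atLeastAtMost)
  have spc: "f v {c, b} = f v {c, d}" if "v \<in> B" for v
    using fun_cong[OF eq, of v] that by simp
  let ?ps = "[a, b, c, d, e]"
  show False
  proof (rule good_colorings_no_spoiled_path[OF good, of ?ps])
    have "b \<in> U" "d \<in> U" "a \<in> A" "c \<in> A" "e \<in> A"
      using bd B(1) ace(1) by (auto simp: V_def)
    then show "distinct ?ps" "set ?ps \<subseteq> {1..n}"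
      using AU bd(3) ace(2) by auto
    show "length ?ps = Suc 4"
      by simp
    fix v
    assume "v \<in> set ?ps"
    then consider "v = b" | "v = d" | "v \<in> B"
      using ace by auto
    then show "\<exists>as y x z bs. ?ps = as @ [y, x, z] @ bs \<and> f v {x, y} = f v {x, z}"
    proof cases
      case 1
      then have "?ps = [] @ [a, b, c] @ [d, e] \<and> f v {b, a} = f v {b, c}"
        using bd by (simp add: V_def)
      then show ?thesis by blast
    next
      case 2
      then have "?ps = [a, b] @ [c, d, e] @ [] \<and> f v {d, c} = f v {d, e}"
        using bd by (simp add: V_def)
      then show ?thesis by blast
    next
      case 3
      then have "?ps = [a] @ [b, c, d] @ [e] \<and> f v {c, b} = f v {c, d}"
        using spc by simp
      then show ?thesis by blast
    qed
  qed
qed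

section \<open>From polynomial bounds to asymptotic lower bounds\<close>

lemma C_num_path_bigomega:
  assumes "p > 0"
    and bound: "\<And>n k f. good_colorings n (path_graph t) k f \<Longrightarrow> n \<ge> 2 \<Longrightarrow> n \<le> D * k ^ p"
  shows "(\<lambda>n. real (C_num n (path_graph t))) \<in> \<Omega>(\<lambda>n. real n powr (1 / real p))"
proof (rule landau_omega.bigI)
  \<comment> \<open>This is the constant left after taking \<open>p\<close>-th roots;
    \<open>D + 1\<close> in place of \<open>D\<close> avoids dividing by zero.\<close>
  define c where "c = (1 / (real D + 1)) powr (1 / real p)"
  show "c > 0"
    by (simp add: c_def)
  show "\<forall>\<^sub>F n in sequentially.
      norm (real (C_num n (path_graph t))) \<ge> c * norm (real n powr (1 / real p))"
    using eventually_ge_at_top[of 2]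
  proof eventually_elim
    case (elim n)
    let ?k = "C_num n (path_graph t)"
    \<comment> \<open>The least \<open>k\<close> is attained because some good coloring exists, so
      \<open>bound\<close> applies to \<open>C_num\<close> itself.\<close>
    obtain f where "good_colorings n (path_graph t) ?k f"
      using LeastI_ex[OF good_colorings_exists[of n t]] unfolding C_num_def by blast
    then have "n \<le> D * ?k ^ p"
      using bound elim by blast
    then have "real n \<le> real D * real ?k ^ p"
      by (metis of_nat_le_iff of_nat_mult of_nat_power)
    also have "\<dots> \<le> (real D + 1) * real ?k ^ p"
      by (simp add: mult_right_mono)
    finally have "1 / (real D + 1) * real n \<le> real ?k ^ p"
      by (simp add: field_simps)
    then have "(1 / (real D + 1) * real n) powr (1 / real p) \<le> (real ?k ^ p) powr (1 / real p)"
      by (intro powr_mono2) auto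
    also have "\<dots> = real ?k"
      using \<open>p > 0\<close> by (simp add: powr_realpow' powr_powr flip: powr_realpow')
    finally show ?case
      unfolding c_def by (subst (asm) powr_mult) auto
  qed
qed

theorem theorem4:
  shows "(\<lambda>n. real (C_num n (path_graph 4))) \<in> \<Omega>(\<lambda>n. real n powr (1/5)) \<and>
    (\<forall>t\<in>{5,6,7}. (\<lambda>n. real (C_num n (path_graph t))) \<in> \<Omega>(\<lambda>n. real n powr (1/3))) \<and>
    (\<forall>t\<ge>8. (\<lambda>n. real (C_num n (path_graph t))) \<in> \<Omega>(\<lambda>n. real n powr (1/2)))"
proof (intro conjI ballI allI impI)
  show "(\<lambda>n. real (C_num n (path_graph 4))) \<in> \<Omega>(\<lambda>n. real n powr (1/5))"
    using C_num_path_bigomega[of 5 4 30] good_colorings_path_4 by simp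
next
  fix t :: nat
  assume "t \<in> {5, 6, 7}"
  then have "t \<ge> 5"
    by auto
  then show "(\<lambda>n. real (C_num n (path_graph t))) \<in> \<Omega>(\<lambda>n. real n powr (1/3))"
    using C_num_path_bigomega[of 3 t "4 * (t + 11)"] good_colorings_path_ge_5 by simp
next
  fix t :: nat
  assume "t \<ge> 8"
  then show "(\<lambda>n. real (C_num n (path_graph t))) \<in> \<Omega>(\<lambda>n. real n powr (1/2))"
    using C_num_path_bigomega[of 2 t "4 * (t + 11)"] good_colorings_path_ge_8 by simp
qed

end
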